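(* Let $d\ge 1$, let $X\subset\mathbb{R}^d$ be convex and bounded, let $f^*:X\to\mathbb{R}$ be convex and differentiable, and let $X_d=\{x_0,\dots,x_d\}\subset X$ be a set of $d+1$ points such that the point of interest $x^*=0$ lies in the interior of the convex hull $\mathcal{C}(X_d)$. Let the relative vectors $x_i$ (i.e. the sampling points relative to $x^*=0$) have unit length. Let $$A=\{v\in\mathbb{R}^d : v\cdot x_i\le\nabla f^*(x_i)\cdot x_i,\ i=0,\dots,d\},\qquad F_i=\{v\in\mathbb{R}^d : v\cdot x_i=\nabla f^*(x_i)\cdot x_i\},$$ and let $v_i=\bigcap_{j\neq i}F_j$ be the vertex of $A$ opposing the face $F_i$, $i=0,\dots,d$. Put $x_i^n=x_i/\|x_i\|_2$, and for each $i$ let $X_i=[x_0^n,\dots,x_{i-1}^n,x_{i+1}^n,\dots,x_d^n]^T\in\mathbb{R}^{d\times d}$ be the matrix whose rows are the normalized vectors $x_j^n$, $j\neq i$, and let $$b_i=\left[\nabla f^*(x_0)\cdot x_0^n,\dots,\nabla f^*(x_{i-1})\cdot x_{i-1}^n,\ \nabla f^*(x_{i+1})\cdot x_{i+1}^n,\dots,\nabla f^*(x_d)\cdot x_d^n\right]^T\in\mathbb{R}^d.$$ Then the vertex $v_i$ is given by $$X_iv_i=b_i .$$ Additionally, the distance between two vertices $v_i$ and $v_j$ can be estimated by $$\|v_i-v_j\|_2\le\left(\|X_i^{-1}\|+\|X_j^{-1}\|\right)C_{x^*},$$ where $C_{x^*}=\max_{k,l\in\{0,\dots,d\}}\|\nabla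 f^*(x_k)-\nabla f^*(x_l)\|_2$ and $\|X_i^{-1}\|$ denotes the corresponding operator norm of $X_i^{-1}$.
   Context: $\cdot$ is the Euclidean inner product on $\mathbb{R}^d$, $\|\cdot\|_2$ the Euclidean norm and $\|\cdot\|_\infty$ the maximum norm. The notation $v_i=\bigcap_{j\neq i}F_j$ means that $v_i$ is the unique point in the intersection of the $d$ hyperplanes $F_j$, $j\neq i$. The operator norm $\|X_i^{-1}\|$ is that of $X_i^{-1}$ viewed as a linear map $(\mathbb{R}^d,\|\cdot\|_\infty)\to(\mathbb{R}^d,\|\cdot\|_2)$, i.e. $\|X_i^{-1}\|=\sup_{\|y\|_\infty\le 1}\|X_i^{-1}y\|_2$; the matrices $X_i$ are invertible in this setting. *)

theory Defs
  imports "HOL-Analysis.Analysis"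
begin

text \<open>
  The ambient space is \<open>real ^ 'n\<close> with \<open>d = CARD('n)\<close>; the sampling points are
  \<open>x 0, \<dots>, x d\<close>, and \<open>g\<close> stands for the gradient of the sampled function.
\<close>

definition gradient_polytope :: "nat \<Rightarrow> (nat \<Rightarrow> real ^ 'n) \<Rightarrow> (real ^ 'n \<Rightarrow> real ^ 'n) \<Rightarrow> (real ^ 'n) set"
  where "gradient_polytope d x g = {v. \<forall>i\<in>{0..d}. v \<bullet> x i \<le> g (x i) \<bullet> x i}"

definition face_plane :: "(nat \<Rightarrow> real ^ 'n) \<Rightarrow> (real ^ 'n \<Rightarrow> real ^ 'n) \<Rightarrow> nat \<Rightarrow> (real ^ 'n) set"
  where "face_plane x g i = {v. v \<bullet> x i = g (x i) \<bullet> x i}"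

definition opposing_vertex :: "nat \<Rightarrow> (nat \<Rightarrow> real ^ 'n) \<Rightarrow> (real ^ 'n \<Rightarrow> real ^ 'n) \<Rightarrow> nat \<Rightarrow> real ^ 'n"
  where "opposing_vertex d x g i = (THE v. v \<in> (\<Inter>j\<in>{0..d} - {i}. face_plane x g j))"

definition normalized :: "real ^ 'n \<Rightarrow> real ^ 'n"
  where "normalized y = y /\<^sub>R norm y"

text \<open>
  The increasing enumeration \<open>0, \<dots>, i - 1, i + 1, \<dots>, d\<close> of the indices different from \<open>i\<close>.
\<close>

definition skip :: "nat \<Rightarrow> nat \<Rightarrow> nat"
  where "skip i k = (if k < i then k else Suc k)"

text \<open>
  The rows of a matrix of type \<open>real ^ 'n ^ 'n\<close> are indexed by the unordered type \<open>'n\<close>. The map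
  \<open>e\<close>, meant to be a bijection from \<open>'n\<close> onto \<open>{0..<d}\<close>, gives the position of each row.
\<close>

definition point_matrix :: "('n \<Rightarrow> nat) \<Rightarrow> (nat \<Rightarrow> real ^ 'n) \<Rightarrow> nat \<Rightarrow> real ^ 'n ^ 'n"
  where "point_matrix e x i = (\<chi> r. normalized (x (skip i (e r))))"

definition slope_vector ::
    "('n \<Rightarrow> nat) \<Rightarrow> (nat \<Rightarrow> real ^ 'n) \<Rightarrow> (real ^ 'n \<Rightarrow> real ^ 'n) \<Rightarrow> nat \<Rightarrow> real ^ 'n"
  where "slope_vector e x g i =
    (\<chi> r. g (x (skip i (e r))) \<bullet> normalized (x (skip i (e r))))"

text \<open>Operator norm from the maximum norm on the domain to the Euclidean norm on the codomain.\<close>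

definition opnorm_max_euclid :: "real ^ 'n ^ 'm \<Rightarrow> real"
  where "opnorm_max_euclid M = (SUP y\<in>{y. infnorm y \<le> 1}. norm (M *v y))"

definition gradient_spread :: "nat \<Rightarrow> (nat \<Rightarrow> real ^ 'n) \<Rightarrow> (real ^ 'n \<Rightarrow> real ^ 'n) \<Rightarrow> real"
  where "gradient_spread d x g =
    Max ((\<lambda>(k, l). norm (g (x k) - g (x l))) ` ({0..d} \<times> {0..d}))"

end

theory Submission
  imports Defs
begin

text \<open>
  Both claims rest on one property of the configuration: a vector \<open>w\<close> with \<open>w \<bullet> x k \<ge> 0\<close> for all
  \<open>k\<close> vanishes, because the half-space \<open>{y. 0 \<le> w \<bullet> y}\<close> then contains the convex hull of the points
  and hence a neighbourhood of the origin (\<open>nonneg_inner_interior_hull_imp_zero\<close>).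

  A vector orthogonal to all points but one has a fixed sign against the remaining point, so it
  vanishes as well. This makes every \<open>X\<^sub>i\<close> injective and the intersection of the hyperplanes \<open>F\<^sub>j\<close>,
  \<open>j \<noteq> i\<close>, a single point \<open>v\<^sub>i\<close>; as the points are unit vectors, the equations of these hyperplanes
  are the rows of \<open>X\<^sub>i v = b\<^sub>i\<close>. The same property shows that \<open>v\<^sub>i\<close> belongs to the polytope \<open>A\<close>. By
  monotonicity of the gradient, \<open>\<nabla>f(0)\<close> lies in \<open>A\<close>. If \<open>v\<^sub>i\<close> violated its one remaining inequality,
  then \<open>w = v\<^sub>i - \<nabla>f(0)\<close> would satisfy \<open>w \<bullet> x k \<ge> 0\<close> for all \<open>k\<close>, with strict inequality for
  \<open>k = i\<close>, which is absurd. A point of \<open>A\<close> at which \<open>d\<close> constraints are active and determine it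
  uniquely is extreme.

  For the distance estimate, both vertices are compared with one of the sampled gradients,
  \<open>a = \<nabla>f(x 0)\<close>. The entries of \<open>X\<^sub>i (v\<^sub>i - a)\<close> are \<open>(\<nabla>f(x k) - a) \<bullet> x k\<close>, at most \<open>C\<close> in absolute
  value by the Cauchy-Schwarz inequality. Therefore \<open>\<parallel>v\<^sub>i - a\<parallel> \<le> \<parallel>X\<^sub>i\<^sup>-\<^sup>1\<parallel> C\<close>, and the triangle
  inequality finishes the proof.
\<close>

section \<open>Monotonicity of the gradient of a convex function\<close>

text \<open>
  The difference quotients of \<open>f\<close> along the segment from \<open>y\<close> to \<open>z\<close> are at most \<open>f z - f y\<close>, and
  so is their limit. Only the derivative relative to \<open>X\<close> is involved, so \<open>y\<close> may be a boundary
  point.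
\<close>

lemma convex_on_above_tangent_within:
  fixes f :: "'a::real_normed_vector \<Rightarrow> real"
  assumes f: "convex_on X f" and y: "y \<in> X" and z: "z \<in> X"
    and D: "(f has_derivative D) (at y within X)"
  shows "f y + D (z - y) \<le> f z"
proof -
  define p where "p t = y + t *\<^sub>R (z - y)" for t :: real
  have p_convex: "p t = (1 - t) *\<^sub>R y + t *\<^sub>R z" for t
    by (simp add: p_def algebra_simps)
  have "convex X"
    using f by (simp add: convex_on_def)
  then have pX: "p ` {0..1} \<subseteq> X"
    using y z by (auto simp: p_convex convex_alt)
  have "(p has_derivative (\<lambda>t. t *\<^sub>R (z - y))) (at 0 within {0..1})"
    unfolding p_def by (auto intro!: derivative_eq_intros)
  moreover have "(f has_derivative D) (at (p 0) within p ` {0..1})"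
    using has_derivative_subset[OF D pX] by (simp add: p_def)
  ultimately have "(f \<circ> p has_derivative D \<circ> (\<lambda>t. t *\<^sub>R (z - y))) (at 0 within {0..1})"
    by (rule diff_chain_within)
  moreover have "D \<circ> (\<lambda>t. t *\<^sub>R (z - y)) = (*) (D (z - y))"
    using linear_cmul[OF has_derivative_linear[OF D]] by (auto simp: mult.commute)
  ultimately have "((f \<circ> p) has_field_derivative D (z - y)) (at 0 within {0..1})"
    by (simp add: has_field_derivative_def)
  then have lim: "((\<lambda>t. (f (p t) - f y) / t) \<longlongrightarrow> D (z - y)) (at 0 within {0..1})"
    by (simp add: has_field_derivative_iff p_def)
  have "(f (p t) - f y) / t \<le> f z - f y" if "t \<in> {0..1}" "t \<noteq> 0" for t
  proof -
    have "f (p t) \<le> (1 - t) * f y + t * f z"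
      using that convex_onD[OF f, of t y z] y z by (simp add: p_convex)
    then show ?thesis
      using that by (simp add: field_simps)
  qed
  then have "\<forall>\<^sub>F t in at 0 within {0..1}. (f (p t) - f y) / t \<le> f z - f y"
    by (simp add: eventually_at_filter)
  moreover have "at (0::real) within {0..1} \<noteq> bot"
    by (simp add: trivial_limit_within)
  ultimately have "D (z - y) \<le> f z - f y"
    using tendsto_upperbound[OF lim] by blast
  then show ?thesis
    by simp
qed

lemma convex_on_gradient_monotone:
  fixes f :: "'a::real_inner \<Rightarrow> real"
  assumes f: "convex_on X f"
    and g: "\<And>y. y \<in> X \<Longrightarrow> (f has_derivative (\<lambda>h. g y \<bullet> h)) (at y within X)"
    and y: "y \<in> X" and z: "z \<in> X"
  shows "0 \<le> (g y - g z) \<bullet> (y - z)"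
  using convex_on_above_tangent_within[OF f y z g[OF y]]
    convex_on_above_tangent_within[OF f z y g[OF z]]
  by (simp add: inner_diff_left inner_diff_right)

section \<open>Points whose convex hull surrounds the origin\<close>

lemma nonneg_inner_interior_hull_imp_zero:
  fixes w :: "'a::real_inner"
  assumes int: "0 \<in> interior (convex hull S)" and w: "\<And>s. s \<in> S \<Longrightarrow> 0 \<le> w \<bullet> s"
  shows "w = 0"
proof (rule ccontr)
  assume "w \<noteq> 0"
  have "convex hull S \<subseteq> {y. 0 \<le> w \<bullet> y}"
    using w by (intro hull_minimal) (auto simp: convex_halfspace_ge[of 0 w, simplified])
  moreover obtain r where "r > 0" "cball 0 r \<subseteq> convex hull S"
    using int by (meson mem_interior_cball)
  \<comment> \<open>the point of norm \<open>r\<close> opposite to \<open>w\<close>, strictly outside the half-space\<close>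
  moreover have "- (r / norm w) *\<^sub>R w \<in> cball 0 r"
    using \<open>r > 0\<close> by simp
  ultimately have "0 \<le> w \<bullet> (- (r / norm w) *\<^sub>R w)"
    by blast
  then show False
    using mult_pos_pos[of r "norm w"] \<open>r > 0\<close> \<open>w \<noteq> 0\<close>
    by (simp add: dot_square_norm power2_eq_square not_le[symmetric])
qed

text \<open>
  One point may be dropped, since either \<open>w\<close> or \<open>- w\<close> has a nonnegative inner product with it.
\<close>

lemma orthogonal_all_but_one_imp_zero:
  fixes w :: "'a::real_inner"
  assumes int: "0 \<in> interior (convex hull (x ` I))"
    and w: "\<And>k. k \<in> I - {i} \<Longrightarrow> w \<bullet> x k = 0"
  shows "w = 0"
proof (cases "0 \<le> w \<bullet> x i")
  case True
  then have "0 \<le> w \<bullet> s" if "s \<in> x ` I" for s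
    using that w by (force simp: le_less)
  then show ?thesis
    by (rule nonneg_inner_interior_hull_imp_zero[OF int])
next
  case False
  then have "0 \<le> (- w) \<bullet> s" if "s \<in> x ` I" for s
    using that w by (force simp: le_less)
  then have "- w = 0"
    by (rule nonneg_inner_interior_hull_imp_zero[OF int])
  then show ?thesis
    by simp
qed

section \<open>The operator norm from the maximum norm to the Euclidean norm\<close>

text \<open>
  The supremum defining the norm is over a bounded set, because the maximum norm and the Euclidean
  norm are equivalent; it is therefore a genuine upper bound.
\<close>

lemma norm_matrix_vector_le_opnorm_max_euclid:
  fixes M :: "real ^ 'n ^ 'm"
  assumes y: "infnorm y \<le> c"
  shows "norm (M *v y) \<le> opnorm_max_euclid M * c"
proof (cases "c = 0")
  case True
  then show ?thesis
    using y infnorm_pos_le[of y] by (simp add: infnorm_eq_0)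
next
  case False
  then have "c > 0"
    using y infnorm_pos_le[of y] by linarith
  obtain K where K: "K > 0" "\<And>u. norm (M *v u) \<le> K * norm u"
    using linear_bounded_pos[OF matrix_vector_mul_linear[of M]] by blast
  have "norm (M *v u) \<le> K * sqrt DIM(real ^ 'n)" if "infnorm u \<le> 1" for u
  proof -
    have "norm u \<le> sqrt DIM(real ^ 'n) * infnorm u"
      by (rule norm_le_infnorm)
    also have "\<dots> \<le> sqrt DIM(real ^ 'n)"
      using that by (simp add: mult_left_le)
    finally show ?thesis
      using K by (meson mult_left_mono less_imp_le order_trans)
  qed
  then have "bdd_above ((\<lambda>u. norm (M *v u)) ` {u. infnorm u \<le> 1})"
    by (auto intro!: bdd_aboveI2)
  moreover have "(1 / c) *\<^sub>R y \<in> {u. infnorm u \<le> 1}"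
    using y \<open>c > 0\<close> by (simp add: infnorm_mul)
  ultimately have "norm (M *v ((1 / c) *\<^sub>R y)) \<le> opnorm_max_euclid M"
    unfolding opnorm_max_euclid_def by (rule cSUP_upper2) auto
  then show ?thesis
    using \<open>c > 0\<close> by (simp add: matrix_vector_mult_scaleR field_simps)
qed

lemma infnorm_le_componentwise:
  fixes y :: "real ^ 'n"
  assumes "\<And>r. \<bar>y $ r\<bar> \<le> c"
  shows "infnorm y \<le> c"
  unfolding infnorm_cart using assms by (intro cSup_least) auto

section \<open>The linear system of a vertex\<close>

lemma skip_image:
  assumes "i \<le> d"
  shows "skip i ` {0..<d} = {0..d} - {i}"
proof (intro set_eqI iffI)
  fix k assume k: "k \<in> {0..d} - {i}"
  have "k = skip i (if k < i then k else k - 1)"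
    using k by (auto simp: skip_def)
  moreover have "(if k < i then k else k - 1) \<in> {0..<d}"
    using k assms by auto
  ultimately show "k \<in> skip i ` {0..<d}"
    by blast
qed (use assms in \<open>auto simp: skip_def split: if_splits\<close>)

lemma range_skip_enumeration:
  assumes "bij_betw e UNIV {0..<d}" and "i \<le> d"
  shows "range (\<lambda>r. skip i (e r)) = {0..d} - {i}"
  using bij_betw_imp_surj_on[OF assms(1)] skip_image[OF assms(2)] by (metis image_image)

lemma matrix_inv_right_left:
  assumes "invertible M"
  shows "M ** matrix_inv M = mat 1" "matrix_inv M ** M = mat 1"
  using someI_ex[OF assms[unfolded invertible_def]] unfolding matrix_inv_def by auto

lemma point_matrix_mult_nth:
  assumes "norm (x (skip i (e r))) = 1"
  shows "(point_matrix e x i *v v) $ r = v \<bullet> x (skip i (e r))"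
  using assms
  by (simp add: point_matrix_def normalized_def matrix_vector_mul_component inner_commute)

lemma slope_vector_nth:
  assumes "norm (x (skip i (e r))) = 1"
  shows "slope_vector e x g i $ r = g (x (skip i (e r))) \<bullet> x (skip i (e r))"
  using assms by (simp add: slope_vector_def normalized_def)

text \<open>
  For unit vectors the normalization is the identity, and reading \<open>X\<^sub>i v = b\<^sub>i\<close> row by row gives
  exactly the equations of the hyperplanes \<open>F\<^sub>j\<close>, \<open>j \<noteq> i\<close>.
\<close>

lemma point_matrix_system_iff:
  assumes e: "bij_betw e UNIV {0..<d}" and i: "i \<le> d"
    and unit: "\<And>k. k \<in> {0..d} \<Longrightarrow> norm (x k) = 1"
  shows "point_matrix e x i *v v = slope_vector e x g i \<longleftrightarrow>
    v \<in> (\<Inter>j\<in>{0..d} - {i}. face_plane x g j)"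
proof -
  note ran = range_skip_enumeration[OF e i]
  have idx: "skip i (e r) \<in> {0..d}" for r
    using ran by blast
  have "point_matrix e x i *v v = slope_vector e x g i \<longleftrightarrow>
      (\<forall>k\<in>range (\<lambda>r. skip i (e r)). v \<bullet> x k = g (x k) \<bullet> x k)"
    using point_matrix_mult_nth[of x i e, OF unit[OF idx]] slope_vector_nth[of x i e, OF unit[OF idx]]
    by (simp add: vec_eq_iff)
  then show ?thesis
    by (simp add: ran face_plane_def)
qed

lemma invertible_point_matrix:
  assumes e: "bij_betw e UNIV {0..<d}" and i: "i \<le> d"
    and unit: "\<And>k. k \<in> {0..d} \<Longrightarrow> norm (x k) = 1"
    and int: "0 \<in> interior (convex hull (x ` {0..d}))"
  shows "invertible (point_matrix e x i)"
proof -
  note ran = range_skip_enumeration[OF e i]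
  have idx: "skip i (e r) \<in> {0..d}" for r
    using ran by blast
  have "w = 0" if "point_matrix e x i *v w = 0" for w
  proof (rule orthogonal_all_but_one_imp_zero[OF int])
    fix k assume "k \<in> {0..d} - {i}"
    then obtain r where "k = skip i (e r)"
      using ran by blast
    then show "w \<bullet> x k = 0"
      using that point_matrix_mult_nth[of x i e r w, OF unit[OF idx]] by simp
  qed
  then show ?thesis
    unfolding invertible_left_inverse matrix_left_invertible_ker by blast
qed

lemma face_planes_Inter_eq_opposing_vertex:
  fixes x :: "nat \<Rightarrow> real ^ 'n" and e :: "'n \<Rightarrow> nat"
  assumes e: "bij_betw e UNIV {0..<d}" and i: "i \<le> d"
    and unit: "\<And>k. k \<in> {0..d} \<Longrightarrow> norm (x k) = 1"
    and int: "0 \<in> interior (convex hull (x ` {0..d}))"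
  shows "(\<Inter>j\<in>{0..d} - {i}. face_plane x g j) = {opposing_vertex d x g i}"
proof -
  let ?M = "point_matrix e x i" and ?F = "\<Inter>j\<in>{0..d} - {i}. face_plane x g j"
  have inv: "?M ** matrix_inv ?M = mat 1" "matrix_inv ?M ** ?M = mat 1"
    using matrix_inv_right_left[OF invertible_point_matrix[OF assms]] by auto
  have "?M *v v = slope_vector e x g i \<longleftrightarrow> v = matrix_inv ?M *v slope_vector e x g i" for v
    by (metis inv matrix_vector_mul_assoc matrix_vector_mul_lid)
  then have F: "?F = {matrix_inv ?M *v slope_vector e x g i}"
    by (intro set_eqI)
      (simp only: point_matrix_system_iff[of e d i x, OF e i unit, symmetric] singleton_iff)
  show ?thesis
    unfolding opposing_vertex_def F by simp
qed

section \<open>Membership in the polytope and extremality\<close>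

text \<open>
  The inequalities bounding the polytope could be inconsistent, while the hyperplanes would still
  intersect; hence some point \<open>p\<close> of the polytope has to be given. If \<open>v\<close> lay outside, every
  constraint would be at least as large at \<open>v\<close> as at \<open>p\<close>, with strict inequality for the violated
  one, and \<open>v - p\<close> would be a nonzero vector with nonnegative inner products.
\<close>

lemma face_planes_Inter_subset_gradient_polytope:
  assumes int: "0 \<in> interior (convex hull (x ` {0..d}))"
    and p: "p \<in> gradient_polytope d x g"
    and v: "v \<in> (\<Inter>j\<in>{0..d} - {i}. face_plane x g j)"
  shows "v \<in> gradient_polytope d x g"
proof (rule ccontr)
  assume "v \<notin> gradient_polytope d x g"
  then have viol: "i \<in> {0..d}" "v \<bullet> x i > g (x i) \<bullet> x i"
    using v by (auto simp: gradient_polytope_def face_plane_def) force+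
  have "0 \<le> (v - p) \<bullet> x k" if "k \<in> {0..d}" for k
    using that p v viol
    by (cases "k = i") (force simp: gradient_polytope_def face_plane_def inner_diff_left)+
  then have "v - p = 0"
    by (intro nonneg_inner_interior_hull_imp_zero[OF int]) auto
  then show False
    using p viol by (force simp: gradient_polytope_def)
qed

text \<open>
  If \<open>v\<close> were strictly between two points of the polytope, each constraint active at \<open>v\<close> would be
  active at both of them, and both would coincide with \<open>v\<close>.
\<close>

lemma face_planes_Inter_extreme_point:
  assumes int: "0 \<in> interior (convex hull (x ` {0..d}))"
    and vA: "v \<in> gradient_polytope d x g"
    and v: "v \<in> (\<Inter>j\<in>{0..d} - {i}. face_plane x g j)"
  shows "v extreme_point_of gradient_polytope d x g"
  unfolding extreme_point_of_def
proof (intro conjI ballI notI vA)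
  fix a b
  assume a: "a \<in> gradient_polytope d x g" and b: "b \<in> gradient_polytope d x g"
    and "v \<in> open_segment a b"
  then obtain u where u: "0 < u" "u < 1" and ab: "a \<noteq> b" and vu: "v = (1 - u) *\<^sub>R a + u *\<^sub>R b"
    by (auto simp: in_segment)
  have "(a - b) \<bullet> x k = 0" if k: "k \<in> {0..d} - {i}" for k
  proof -
    define c where "c = g (x k) \<bullet> x k"
    have "a \<bullet> x k \<le> c" "b \<bullet> x k \<le> c" "(1 - u) * (a \<bullet> x k) + u * (b \<bullet> x k) = c"
      using a b v k by (auto simp: gradient_polytope_def face_plane_def c_def vu inner_add_left)
    moreover from this have "(1 - u) * (c - a \<bullet> x k) + u * (c - b \<bullet> x k) = 0"
      by (simp add: algebra_simps)
    ultimately have "(1 - u) * (c - a \<bullet> x k) = 0" "u * (c - b \<bullet> x k) = 0"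
      using u by (smt (verit) mult_nonneg_nonneg)+
    then show ?thesis
      using u by (simp add: inner_diff_left)
  qed
  then have "a - b = 0"
    by (rule orthogonal_all_but_one_imp_zero[OF int])
  with ab show False
    by simp
qed

section \<open>The distance of a vertex from a sampled gradient\<close>

lemma gradient_difference_le_spread:
  assumes "k \<in> {0..d}" "l \<in> {0..d}"
  shows "norm (g (x k) - g (x l)) \<le> gradient_spread d x g"
  unfolding gradient_spread_def by (rule Max_ge) (use assms in force)+

text \<open>
  The reference point is itself one of the sampled gradients, so that the residual of the linear
  system at it consists of differences of sampled gradients, which the spread controls.
\<close>

lemma vertex_gradient_distance_le:
  assumes e: "bij_betw e UNIV {0..<d}" and i: "i \<le> d"
    and unit: "\<And>k. k \<in> {0..d} \<Longrightarrow> norm (x k) = 1"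
    and inv: "invertible (point_matrix e x i)"
    and v: "point_matrix e x i *v v = slope_vector e x g i"
    and l: "l \<in> {0..d}"
  shows "norm (v - g (x l))
    \<le> opnorm_max_euclid (matrix_inv (point_matrix e x i)) * gradient_spread d x g"
proof -
  let ?M = "point_matrix e x i" and ?a = "g (x l)"
  have idx: "skip i (e r) \<in> {0..d}" for r
    using range_skip_enumeration[OF e i] by blast
  have "\<bar>(?M *v (v - ?a)) $ r\<bar> \<le> gradient_spread d x g" for r
  proof -
    define k where "k = skip i (e r)"
    have k: "k \<in> {0..d}"
      using idx k_def by simp
    have "(?M *v (v - ?a)) $ r = slope_vector e x g i $ r - (?M *v ?a) $ r"
      by (simp add: matrix_vector_mult_diff_distrib v)
    also have "\<dots> = (g (x k) - ?a) \<bullet> x k"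
      using point_matrix_mult_nth[of x i e, OF unit[OF idx]] slope_vector_nth[of x i e, OF unit[OF idx]]
      by (simp add: k_def inner_diff_left)
    also have "\<bar>\<dots>\<bar> \<le> norm (g (x k) - ?a)"
      using Cauchy_Schwarz_ineq2[of "g (x k) - ?a" "x k"] unit[OF k] by simp
    also have "\<dots> \<le> gradient_spread d x g"
      by (rule gradient_difference_le_spread[OF k l])
    finally show ?thesis .
  qed
  then have "norm (matrix_inv ?M *v (?M *v (v - ?a)))
      \<le> opnorm_max_euclid (matrix_inv ?M) * gradient_spread d x g"
    by (intro norm_matrix_vector_le_opnorm_max_euclid infnorm_le_componentwise)
  moreover have "matrix_inv ?M *v (?M *v (v - ?a)) = v - ?a"
    using matrix_inv_right_left[OF inv] by (simp add: matrix_vector_mul_assoc)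
  ultimately show ?thesis
    by simp
qed

section \<open>Vertices of the gradient polytope\<close>

theorem theorem2:
  fixes d :: nat
    and X :: "(real ^ 'n) set"
    and f :: "real ^ 'n \<Rightarrow> real"
    and g :: "real ^ 'n \<Rightarrow> real ^ 'n"
    and x :: "nat \<Rightarrow> real ^ 'n"
    and e :: "'n \<Rightarrow> nat"
  assumes "d = CARD('n)"
    and "convex X" and "bounded X"
    and "convex_on X f"
    and "\<And>y. y \<in> X \<Longrightarrow> (f has_derivative (\<lambda>h. g y \<bullet> h)) (at y within X)"
    and "inj_on x {0..d}" and "x ` {0..d} \<subseteq> X"
    and "0 \<in> interior (convex hull (x ` {0..d}))"
    and "\<And>i. i \<in> {0..d} \<Longrightarrow> norm (x i) = 1"
    and "bij_betw e UNIV {0..<d}"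
  shows "(\<forall>i\<in>{0..d}.
            (\<Inter>j\<in>{0..d} - {i}. face_plane x g j) = {opposing_vertex d x g i} \<and>
            opposing_vertex d x g i extreme_point_of gradient_polytope d x g \<and>
            invertible (point_matrix e x i) \<and>
            point_matrix e x i *v opposing_vertex d x g i = slope_vector e x g i) \<and>
         (\<forall>i\<in>{0..d}. \<forall>j\<in>{0..d}.
            norm (opposing_vertex d x g i - opposing_vertex d x g j)
              \<le> (opnorm_max_euclid (matrix_inv (point_matrix e x i))
                  + opnorm_max_euclid (matrix_inv (point_matrix e x j)))
                * gradient_spread d x g)"
proof -
  note convX = assms(2) and convf = assms(4) and deriv = assms(5) and xX = assms(7)
    and int = assms(8) and unit = assms(9) and e = assms(10)
  have zeroX: "0 \<in> X"
    using int interior_subset hull_minimal[of _ _ convex, OF xX convX] by blast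
  have "g 0 \<bullet> x k \<le> g (x k) \<bullet> x k" if "k \<in> {0..d}" for k
  proof -
    have "x k \<in> X"
      using xX that by blast
    then show ?thesis
      using convex_on_gradient_monotone[OF convf deriv _ zeroX] by (force simp: inner_diff_left)
  qed
  then have g0: "g 0 \<in> gradient_polytope d x g"
    by (simp add: gradient_polytope_def)
  let ?v = "opposing_vertex d x g"
  have planes: "(\<Inter>j\<in>{0..d} - {i}. face_plane x g j) = {?v i}"
    and inv: "invertible (point_matrix e x i)" if "i \<in> {0..d}" for i
    using that face_planes_Inter_eq_opposing_vertex[of e d i x g, OF e _ unit int]
      invertible_point_matrix[of e d i x, OF e _ unit int] by auto
  have system: "point_matrix e x i *v ?v i = slope_vector e x g i" if "i \<in> {0..d}" for i
    using planes[OF that] point_matrix_system_iff[of e d i x "?v i" g, OF e _ unit] that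
    by (metis atLeastAtMost_iff singletonI)
  have extreme: "?v i extreme_point_of gradient_polytope d x g" if "i \<in> {0..d}" for i
  proof -
    have "?v i \<in> (\<Inter>j\<in>{0..d} - {i}. face_plane x g j)"
      using planes[OF that] by blast
    then show ?thesis
      using face_planes_Inter_extreme_point[OF int]
        face_planes_Inter_subset_gradient_polytope[OF int g0] by blast
  qed
  have near: "norm (?v i - g (x 0))
      \<le> opnorm_max_euclid (matrix_inv (point_matrix e x i)) * gradient_spread d x g"
    if "i \<in> {0..d}" for i
    using that vertex_gradient_distance_le[of e d i x "?v i" g 0, OF e _ unit inv[OF that] system[OF that]] by simp
  have "norm (?v i - ?v j)
      \<le> (opnorm_max_euclid (matrix_inv (point_matrix e x i))
          + opnorm_max_euclid (matrix_inv (point_matrix e x j))) * gradient_spread d x g"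
    if "i \<in> {0..d}" "j \<in> {0..d}" for i j
    using norm_triangle_ineq4[of "?v i - g (x 0)" "?v j - g (x 0)"] near[OF that(1)] near[OF that(2)]
    by (simp add: distrib_right)
  then show ?thesis
    using planes extreme inv system by blast
qed

end
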